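(* Let $\lambda,\mu>0$ and $\alpha=\sqrt{\mu/\lambda}$. Let $\{X(t)\}_{t\ge0}$ be the birth and death process on $\mathbb{N}_0=\{0,1,2,\dots\}$ with $X(0)=0$, birth rates $\lambda_k=\frac{\lambda}{1+k}$ and death rates $\mu_k=k\mu$ ($k\ge 0$), and for $n,k\ge 0$ let $p_{n,k}$ be the probability that its embedded jump chain is in state $k$ after $n$ jumps. Then $$\begin{cases} p_{n+1,k}=\dfrac{1}{1+k(k-1)\alpha^2}\,p_{n,k-1}+\dfrac{(k+2)(k+1)\alpha^2}{1+(k+2)(k+1)\alpha^2}\,p_{n,k+1}, & \forall n\ge 0,\ 1\le k\le n+1,\\[6pt] p_{n,k}=0,\ \ \forall k>n,\qquad p_{0,0}=1.\end{cases}$$ Furthermore $$\begin{cases} p_{n,k}=d_k\,T^{\left(\frac{n-k}{2}\right)}_k, & n\ge 0,\ 0\le k\le n,\ n+k \text{ even},\\[2pt] p_{n,k}=0, & \text{otherwise},\end{cases}$$ where $$d_k=\prod_{i=0}^{k}\frac{1}{1+i(i-1)\alpha^2},\qquad T^{(0)}_k=1\ \ \forall k\ge 0,\qquad T^{(h)}_k=\sum_{i=0}^{k}\frac{d_{i+1}-d_{i+2}}{d_i}\,T^{(h-1)}_{i+1}\ \ \forall k\ge 0,\ h\ge 1.$$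
   Context: The embedded jump chain is the discrete-time Markov chain on $\mathbb{N}_0$ of successive states visited by $\{X(t)\}$, started at $0$; from state $k$ it moves to $k+1$ with probability $\lambda_k/(\lambda_k+\mu_k)$ and (for $k\ge1$) to $k-1$ with probability $\mu_k/(\lambda_k+\mu_k)$. *)

theory Defs
  imports "HOL-Probability.Probability"
begin

text \<open>
  A path \<open>x :: real \<Rightarrow> nat\<close> is only looked at on times \<open>t \<ge> 0\<close>.  Jump times are extended reals:
  since \<open>Inf {} = \<infinity>\<close>, the next jump time is \<open>\<infinity>\<close> if there is no further jump.
\<close>

primrec jump_time :: "(real \<Rightarrow> nat) \<Rightarrow> nat \<Rightarrow> ereal" where
  "jump_time x 0 = 0"
| "jump_time x (Suc n) =
     Inf {ereal t | t. jump_time x n \<le> ereal t \<and> x t \<noteq> x (real_of_ereal (jump_time x n))}"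

definition holding_time :: "(real \<Rightarrow> nat) \<Rightarrow> nat \<Rightarrow> ereal" where
  "holding_time x n = jump_time x (Suc n) - jump_time x n"

text \<open>
  The state entered at the \<open>n\<close>-th jump.  If there is no \<open>n\<close>-th jump the value is the junk value
  \<open>x 0\<close>; for the processes defined below this happens with probability 0.
\<close>

definition jump_chain :: "(real \<Rightarrow> nat) \<Rightarrow> nat \<Rightarrow> nat" where
  "jump_chain x n = x (real_of_ereal (jump_time x n))"

text \<open>
  Time-homogeneous Markov chains with transition matrix \<open>P\<close>.  The Markov property is written in
  product form, so that conditioning on null events needs no convention.
\<close>

definition markov_chain :: "'a measure \<Rightarrow> ('s \<Rightarrow> 's \<Rightarrow> real) \<Rightarrow> (nat \<Rightarrow> 'a \<Rightarrow> 's) \<Rightarrow> bool" where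
  "markov_chain M P Y \<longleftrightarrow>
     prob_space M \<and>
     (\<forall>n. Y n \<in> measurable M (count_space UNIV)) \<and>
     (\<forall>n i j. measure M {\<omega> \<in> space M. (\<forall>m\<le>n. Y m \<omega> = i m) \<and> Y (Suc n) \<omega> = j}
            = measure M {\<omega> \<in> space M. \<forall>m\<le>n. Y m \<omega> = i m} * P (i n) j)"

definition bd_transition :: "(nat \<Rightarrow> real) \<Rightarrow> (nat \<Rightarrow> real) \<Rightarrow> nat \<Rightarrow> nat \<Rightarrow> real" where
  "bd_transition b d i j =
     (if j = i + 1 then b i / (b i + d i)
      else if i \<ge> 1 \<and> j = i - 1 then d i / (b i + d i)
      else 0)"

text \<open>
  Birth and death processes with birth rates \<open>b\<close> and death rates \<open>d\<close>, via the jump chain and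
  holding time characterisation of continuous-time Markov chains: the paths are right-continuous,
  the jump chain is a Markov chain, and conditionally on the jump chain the holding times are
  independent, the one in state \<open>i\<close> being exponential with parameter \<open>b i + d i\<close>.  The definition
  is meant for rates without absorbing states, i.e. \<open>b i + d i > 0\<close> for all \<open>i\<close>, with \<open>d 0 = 0\<close>.
\<close>

definition birth_death_process ::
    "'a measure \<Rightarrow> (nat \<Rightarrow> real) \<Rightarrow> (nat \<Rightarrow> real) \<Rightarrow> (real \<Rightarrow> 'a \<Rightarrow> nat) \<Rightarrow> bool" where
  "birth_death_process M b d X \<longleftrightarrow>
     prob_space M \<and>
     (\<forall>t\<ge>0. X t \<in> measurable M (count_space UNIV)) \<and>
     (AE \<omega> in M. \<forall>t\<ge>0. continuous (at_right t) (\<lambda>s. X s \<omega>)) \<and>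
     markov_chain M (bd_transition b d) (\<lambda>n \<omega>. jump_chain (\<lambda>t. X t \<omega>) n) \<and>
     (\<forall>n. (\<lambda>\<omega>. holding_time (\<lambda>t. X t \<omega>) n) \<in> borel_measurable M) \<and>
     (\<forall>n i (s :: nat \<Rightarrow> real). (\<forall>m\<le>n. 0 \<le> s m) \<longrightarrow>
        measure M {\<omega> \<in> space M. \<forall>m\<le>n. jump_chain (\<lambda>t. X t \<omega>) m = i m \<and>
                                       holding_time (\<lambda>t. X t \<omega>) m > ereal (s m)}
      = measure M {\<omega> \<in> space M. \<forall>m\<le>n. jump_chain (\<lambda>t. X t \<omega>) m = i m}
        * (\<Prod>m\<le>n. exp (- (b (i m) + d (i m)) * s m)))"

definition d_coeff :: "real \<Rightarrow> nat \<Rightarrow> real" where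
  "d_coeff \<alpha> k = (\<Prod>i=0..k. 1 / (1 + real i * (real i - 1) * \<alpha>\<^sup>2))"

text \<open>\<open>T_coeff \<alpha> h k\<close> is \<open>T\<close> with superscript \<open>(h)\<close> and subscript \<open>k\<close>.\<close>

primrec T_coeff :: "real \<Rightarrow> nat \<Rightarrow> nat \<Rightarrow> real" where
  "T_coeff \<alpha> 0 k = 1"
| "T_coeff \<alpha> (Suc h) k =
     (\<Sum>i=0..k. (d_coeff \<alpha> (i + 1) - d_coeff \<alpha> (i + 2)) / d_coeff \<alpha> i * T_coeff \<alpha> h (i + 1))"

end

theory Submission
  imports Defs
begin

text \<open>
  Summing the Markov property over the last state gives the one-step recurrence for the
  distribution of the jump chain, in which the birth probability out of state \<open>k\<close> is
  \<open>1 / (1 + k (k + 1) \<alpha>\<^sup>2) = d\<^sub>k\<^sub>+\<^sub>1 / d\<^sub>k\<close>.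
  Substituting \<open>p\<^sub>n\<^sub>,\<^sub>k = d\<^sub>k T\<^sub>k\<close> therefore turns the recurrence into
  \<open>T\<^sub>k\<^sup>(\<^sup>h\<^sup>) = T\<^sub>k\<^sub>-\<^sub>1\<^sup>(\<^sup>h\<^sup>) + (d\<^sub>k\<^sub>+\<^sub>1 - d\<^sub>k\<^sub>+\<^sub>2) / d\<^sub>k \<cdot> T\<^sub>k\<^sub>+\<^sub>1\<^sup>(\<^sup>h\<^sup>-\<^sup>1\<^sup>)\<close>,
  whose solution is the telescoped sum that defines \<open>T\<close>.
\<close>

section \<open>One-step laws of Markov chains on countable state spaces\<close>

lemma (in prob_space) prob_sums_countable:
  fixes g :: "'a \<Rightarrow> nat"
  assumes g: "g \<in> measurable M (count_space UNIV)"
    and Q: "{\<omega> \<in> space M. Q \<omega>} \<in> sets M"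
  shows "(\<lambda>i. prob {\<omega> \<in> space M. g \<omega> = i \<and> Q \<omega>}) sums prob {\<omega> \<in> space M. Q \<omega>}"
proof -
  let ?A = "\<lambda>i. {\<omega> \<in> space M. g \<omega> = i \<and> Q \<omega>}"
  have "?A i = (g -` {i} \<inter> space M) \<inter> {\<omega> \<in> space M. Q \<omega>}" for i
    by auto
  then have "range ?A \<subseteq> sets M"
    using measurable_sets[OF g] Q by auto
  moreover have "disjoint_family ?A"
    by (auto simp: disjoint_family_on_def)
  ultimately have "(\<lambda>i. prob (?A i)) sums prob (\<Union>i. ?A i)"
    by (rule finite_measure_UNION)
  moreover have "(\<Union>i. ?A i) = {\<omega> \<in> space M. Q \<omega>}"
    by auto
  ultimately show ?thesis
    by simp
qed

text \<open>\<open>markov_chain\<close> prescribes the next step given the whole history. Each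
  history ending in \<open>i\<close> contributes the same factor \<open>P i j\<close>, and there are
  only countably many, so summing over them forgets the past.\<close>

lemma markov_chain_one_step:
  fixes Y :: "nat \<Rightarrow> 'a \<Rightarrow> 's::countable"
  assumes "markov_chain M P Y"
  shows "measure M {\<omega> \<in> space M. Y n \<omega> = i \<and> Y (Suc n) \<omega> = j}
       = measure M {\<omega> \<in> space M. Y n \<omega> = i} * P i j"
proof -
  interpret prob_space M
    using assms by (simp add: markov_chain_def)
  have Y [measurable]: "Y m \<in> measurable M (count_space UNIV)" for m
    using assms by (simp add: markov_chain_def)
  have markov: "prob {\<omega> \<in> space M. (\<forall>m\<le>n. Y m \<omega> = f m) \<and> Y (Suc n) \<omega> = j}
      = prob {\<omega> \<in> space M. \<forall>m\<le>n. Y m \<omega> = f m} * P (f n) j" for f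
    using assms by (simp add: markov_chain_def)
  \<comment> \<open>The history up to time \<open>n\<close> as a list: lists over a countable type
    are countable, so \<open>to_nat (H \<omega>)\<close> indexes a partition by naturals.\<close>
  define H where "H \<omega> = map (\<lambda>m. Y m \<omega>) [0..<Suc n]" for \<omega>
  have H_eq: "H \<omega> = l \<longleftrightarrow> length l = Suc n \<and> (\<forall>m\<le>n. Y m \<omega> = l ! m)" for \<omega> l
    by (auto simp: H_def list_eq_iff_nth_eq less_Suc_eq_le simp del: upt_Suc)
  have H: "H \<in> measurable M (count_space UNIV)"
  proof -
    have "H -` {l} \<inter> space M = {\<omega> \<in> space M. length l = Suc n \<and> (\<forall>m\<le>n. Y m \<omega> = l ! m)}" for l
      using H_eq by auto
    moreover have "{\<omega> \<in> space M. length l = Suc n \<and> (\<forall>m\<le>n. Y m \<omega> = l ! m)} \<in> sets M" for l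
      by measurable
    ultimately show ?thesis
      by (simp add: measurable_count_space_eq2_countable)
  qed
  have g: "(\<lambda>\<omega>. to_nat (H \<omega>)) \<in> measurable M (count_space UNIV)"
    by (rule measurable_compose[OF H]) simp
  let ?R = "\<lambda>\<omega>. Y n \<omega> = i \<and> Y (Suc n) \<omega> = j"
  \<comment> \<open>If \<open>k\<close> codes a history of length \<open>n + 1\<close> ending in
    \<open>i\<close>, this is the Markov property; for any other \<open>k\<close> both events are
    empty.\<close>
  have cell: "prob {\<omega> \<in> space M. to_nat (H \<omega>) = k \<and> ?R \<omega>}
      = prob {\<omega> \<in> space M. to_nat (H \<omega>) = k \<and> Y n \<omega> = i} * P i j" for k
  proof (cases "\<exists>l. k = to_nat l \<and> length l = Suc n \<and> l ! n = i")
    case True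
    then obtain l where l: "k = to_nat l" "length l = Suc n" "l ! n = i"
      by blast
    then have "{\<omega> \<in> space M. to_nat (H \<omega>) = k \<and> ?R \<omega>}
        = {\<omega> \<in> space M. (\<forall>m\<le>n. Y m \<omega> = l ! m) \<and> Y (Suc n) \<omega> = j}"
      and "{\<omega> \<in> space M. to_nat (H \<omega>) = k \<and> Y n \<omega> = i}
        = {\<omega> \<in> space M. \<forall>m\<le>n. Y m \<omega> = l ! m}"
      by (auto simp: H_eq)
    then show ?thesis
      using markov[of "\<lambda>m. l ! m"] l by simp
  next
    case False
    have "H \<omega> ! n = Y n \<omega>" "length (H \<omega>) = Suc n" for \<omega>
      using H_eq[of \<omega> "H \<omega>"] by auto
    with False have "\<not> (to_nat (H \<omega>) = k \<and> Y n \<omega> = i)" for \<omega>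
      by metis
    then have empty: "{\<omega> \<in> space M. to_nat (H \<omega>) = k \<and> ?R \<omega>} = {}"
      "{\<omega> \<in> space M. to_nat (H \<omega>) = k \<and> Y n \<omega> = i} = {}"
      by blast+
    show ?thesis
      unfolding empty by simp
  qed
  have "(\<lambda>k. prob {\<omega> \<in> space M. to_nat (H \<omega>) = k \<and> ?R \<omega>}) sums prob {\<omega> \<in> space M. ?R \<omega>}"
    by (intro prob_sums_countable g) measurable
  moreover have "(\<lambda>k. prob {\<omega> \<in> space M. to_nat (H \<omega>) = k \<and> Y n \<omega> = i} * P i j)
      sums (prob {\<omega> \<in> space M. Y n \<omega> = i} * P i j)"
    by (intro sums_mult2 prob_sums_countable g) measurable
  ultimately show ?thesis
    unfolding cell by (rule sums_unique2)
qed

lemma markov_chain_sums: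
  fixes Y :: "nat \<Rightarrow> 'a \<Rightarrow> nat"
  assumes "markov_chain M P Y"
  shows "(\<lambda>i. measure M {\<omega> \<in> space M. Y n \<omega> = i} * P i j)
    sums measure M {\<omega> \<in> space M. Y (Suc n) \<omega> = j}"
proof -
  interpret prob_space M
    using assms by (simp add: markov_chain_def)
  have Y [measurable]: "Y m \<in> measurable M (count_space UNIV)" for m
    using assms by (simp add: markov_chain_def)
  have "(\<lambda>i. prob {\<omega> \<in> space M. Y n \<omega> = i \<and> Y (Suc n) \<omega> = j})
      sums prob {\<omega> \<in> space M. Y (Suc n) \<omega> = j}"
    by (intro prob_sums_countable Y) measurable
  then show ?thesis
    by (simp only: markov_chain_one_step[OF assms])
qed

text \<open>Only nearest-neighbour jumps have positive probability, so the series over previous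
  states collapses to \<open>k\<close> and \<open>k + 2\<close>, or to state 1 alone when the target
  is 0.\<close>

lemma bd_markov_chain_step:
  assumes "markov_chain M (bd_transition b d) Y"
  defines "p \<equiv> \<lambda>n k. measure M {\<omega> \<in> space M. Y n \<omega> = k}"
  shows "p (Suc n) (Suc k) = p n k * (b k / (b k + d k))
      + p n (k + 2) * (d (k + 2) / (b (k + 2) + d (k + 2)))" (is ?step)
    and "p (Suc n) 0 = p n 1 * (d 1 / (b 1 + d 1))" (is ?zero)
proof -
  have sums: "(\<lambda>i. p n i * bd_transition b d i j) sums p (Suc n) j" for j
    unfolding p_def by (rule markov_chain_sums[OF assms(1)])
  have "(\<lambda>i. p n i * bd_transition b d i (Suc k)) sums
      (\<Sum>i\<in>{k, k + 2}. p n i * bd_transition b d i (Suc k))"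
    by (rule sums_finite) (auto simp: bd_transition_def)
  from sums_unique2[OF sums this] show ?step
    by (simp add: bd_transition_def)
  have "(\<lambda>i. p n i * bd_transition b d i 0) sums (\<Sum>i\<in>{1}. p n i * bd_transition b d i 0)"
    by (rule sums_finite) (auto simp: bd_transition_def)
  from sums_unique2[OF sums this] show ?zero
    by (simp add: bd_transition_def)
qed

section \<open>The coefficients \<open>d_coeff\<close> and \<open>T_coeff\<close>, and the
  recurrence they solve\<close>

lemma one_plus_consecutive_pos: "0 < 1 + real i * (real i - 1) * \<alpha>\<^sup>2"
  \<comment> \<open>At \<open>i = 0\<close> the factor \<open>real i - 1\<close> is negative, but
    the product vanishes.\<close>
  by (cases i) (auto intro!: add_pos_nonneg)

lemma d_coeff_pos: "0 < d_coeff \<alpha> k"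
  unfolding d_coeff_def using one_plus_consecutive_pos by (intro prod_pos) simp

lemma d_coeff_0: "d_coeff \<alpha> 0 = 1"
  by (simp add: d_coeff_def)

lemma d_coeff_Suc: "d_coeff \<alpha> (Suc k) = d_coeff \<alpha> k * (1 / (1 + real k * (real k + 1) * \<alpha>\<^sup>2))"
  by (simp add: d_coeff_def algebra_simps)

text \<open>The second factor is one minus the birth probability, that is, the death probability out
  of \<open>k\<close>; this is how differences of \<open>d_coeff\<close> enter
  \<open>T_coeff\<close>.\<close>

lemma d_coeff_diff:
  "d_coeff \<alpha> k - d_coeff \<alpha> (Suc k)
     = d_coeff \<alpha> k * ((real k * (real k + 1) * \<alpha>\<^sup>2) / (1 + real k * (real k + 1) * \<alpha>\<^sup>2))"
proof -
  have "1 + real k * (real k + 1) * \<alpha>\<^sup>2 \<noteq> 0"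
    using one_plus_consecutive_pos[of "Suc k" \<alpha>] by (simp add: algebra_simps)
  then show ?thesis
    by (simp add: d_coeff_Suc field_simps)
qed

text \<open>Splits off the last summand \<open>i = Suc k\<close>, with its denominator
  cleared.\<close>

lemma T_coeff_Suc_Suc:
  "d_coeff \<alpha> (Suc k) * T_coeff \<alpha> (Suc h) (Suc k)
     = d_coeff \<alpha> (Suc k) * T_coeff \<alpha> (Suc h) k
       + (d_coeff \<alpha> (k + 2) - d_coeff \<alpha> (k + 3)) * T_coeff \<alpha> h (k + 2)"
  using d_coeff_pos[of \<alpha> "Suc k"]
  by (simp add: field_simps numeral_2_eq_2 numeral_3_eq_3)

lemma d_T_coeff_unique:
  fixes p :: "nat \<Rightarrow> nat \<Rightarrow> real"
  assumes init: "\<And>k. p 0 k = (if k = 0 then 1 else 0)"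
    and step: "\<And>n k. p (Suc n) (Suc k) = 1 / (1 + real k * (real k + 1) * \<alpha>\<^sup>2) * p n k
      + (real (k + 2) * (real (k + 2) + 1) * \<alpha>\<^sup>2)
          / (1 + real (k + 2) * (real (k + 2) + 1) * \<alpha>\<^sup>2) * p n (k + 2)"
    and zero: "\<And>n. p (Suc n) 0 = (2 * \<alpha>\<^sup>2) / (1 + 2 * \<alpha>\<^sup>2) * p n 1"
  shows "p n k = (if k \<le> n \<and> even (n + k) then d_coeff \<alpha> k * T_coeff \<alpha> ((n - k) div 2) k else 0)"
proof (induction n arbitrary: k)
  case 0
  then show ?case
    by (simp add: init d_coeff_0)
next
  case (Suc n)
  show ?case
  proof (cases k)
    case 0
    show ?thesis
    proof (cases "odd n")
      case True
      then obtain h where n: "n = 2 * h + 1"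
        by (auto elim: oddE)
      then have "p n 1 = d_coeff \<alpha> 1 * T_coeff \<alpha> h 1"
        using Suc.IH[of 1] by simp
      \<comment> \<open>At subscript 0 the sum has one term; its coefficient is
        \<open>d_coeff \<alpha> 1\<close> times the death probability out of state 1, as in
        \<open>zero\<close>.\<close>
      moreover have "T_coeff \<alpha> (Suc h) 0 = (d_coeff \<alpha> 1 - d_coeff \<alpha> (Suc 1)) * T_coeff \<alpha> h 1"
        by (simp add: d_coeff_0 numeral_2_eq_2)
      ultimately show ?thesis
        using n unfolding d_coeff_diff by (simp add: 0 zero d_coeff_0)
    next
      case False
      then show ?thesis
        using Suc.IH[of 1] by (simp add: 0 zero)
    qed
  next
    case (Suc j)
    show ?thesis
    proof (cases "j \<le> n \<and> even (n + j)")
      case True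
      then have "even (n - j)"
        by simp
      with True obtain h where n: "n = j + 2 * h"
        by (metis dvdE le_add_diff_inverse)
      have pj: "p n j = d_coeff \<alpha> j * T_coeff \<alpha> h j"
        using Suc.IH[of j] n by simp
      show ?thesis
      proof (cases h)
        \<comment> \<open>Here \<open>j = n\<close>: state \<open>j + 2\<close> is still out of
          reach, so only the birth term remains and every \<open>T_coeff\<close> involved is
          1.\<close>
        case 0
        then have "p n (j + 2) = 0"
          using Suc.IH[of "j + 2"] n by simp
        then show ?thesis
          using pj n 0 by (simp add: Suc step d_coeff_Suc)
      next
        case (Suc h')
        then have "(n - (j + 2)) div 2 = h'" "j + 2 \<le> n" "even (n + (j + 2))"
          using n by simp_all
        then have "p n (j + 2) = d_coeff \<alpha> (j + 2) * T_coeff \<alpha> h' (j + 2)"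
          using Suc.IH[of "j + 2"] by simp
        then have "p (Suc n) (Suc j) = d_coeff \<alpha> (Suc j) * T_coeff \<alpha> (Suc h') j
            + (d_coeff \<alpha> (j + 2) - d_coeff \<alpha> (Suc (j + 2))) * T_coeff \<alpha> h' (j + 2)"
          unfolding step d_coeff_diff d_coeff_Suc[of \<alpha> j] pj Suc by (simp only: ac_simps)
        also have "\<dots> = d_coeff \<alpha> (Suc j) * T_coeff \<alpha> (Suc h') (Suc j)"
          unfolding T_coeff_Suc_Suc by (simp only: numeral_2_eq_2 numeral_3_eq_3 add_Suc_right)
        finally show ?thesis
          using n Suc \<open>k = Suc j\<close> by simp
      qed
    next
      case False
      \<comment> \<open>Both predecessors of \<open>Suc j\<close> share its failure:
        \<open>j + 2\<close> has the parity of \<open>j\<close> and is larger.\<close>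
      then have "p n j = 0" "p n (j + 2) = 0"
        using Suc.IH[of j] Suc.IH[of "j + 2"] by auto
      then show ?thesis
        using False by (auto simp: Suc step)
    qed
  qed
qed

section \<open>The embedded chain of the given process\<close>

theorem proposition9:
  fixes lam mu \<alpha> :: real
    and M :: "'a measure"
    and X :: "real \<Rightarrow> 'a \<Rightarrow> nat"
    and p :: "nat \<Rightarrow> nat \<Rightarrow> real"
  assumes "lam > 0" and "mu > 0"
    and "\<alpha> = sqrt (mu / lam)"
    and "birth_death_process M (\<lambda>k. lam / (1 + real k)) (\<lambda>k. real k * mu) X"
    and "AE \<omega> in M. X 0 \<omega> = 0"
    and "\<And>n k. p n k = measure M {\<omega> \<in> space M. jump_chain (\<lambda>t. X t \<omega>) n = k}"
  shows "(\<forall>n k. 1 \<le> k \<and> k \<le> n + 1 \<longrightarrow>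
            p (n + 1) k =
              1 / (1 + real k * (real k - 1) * \<alpha>\<^sup>2) * p n (k - 1)
              + ((real k + 2) * (real k + 1) * \<alpha>\<^sup>2)
                / (1 + (real k + 2) * (real k + 1) * \<alpha>\<^sup>2) * p n (k + 1))
       \<and> (\<forall>n k. k > n \<longrightarrow> p n k = 0)
       \<and> p 0 0 = 1
       \<and> (\<forall>n k. k \<le> n \<and> even (n + k) \<longrightarrow> p n k = d_coeff \<alpha> k * T_coeff \<alpha> ((n - k) div 2) k)
       \<and> (\<forall>n k. \<not> (k \<le> n \<and> even (n + k)) \<longrightarrow> p n k = 0)"
proof -
  interpret prob_space M
    using assms(4) by (simp add: birth_death_process_def)
  let ?b = "\<lambda>k. lam / (1 + real k)" and ?d = "\<lambda>k. real k * mu"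
  let ?Y = "\<lambda>n \<omega>. jump_chain (\<lambda>t. X t \<omega>) n"
  have chain: "markov_chain M (bd_transition ?b ?d) ?Y"
    using assms(4) by (simp add: birth_death_process_def)
  have X0 [measurable]: "X 0 \<in> measurable M (count_space UNIV)"
    using assms(4) by (simp add: birth_death_process_def)
  have \<alpha>: "\<alpha>\<^sup>2 = mu / lam"
    using assms(1-3) by simp
  have up: "?b k / (?b k + ?d k) = 1 / (1 + real k * (real k + 1) * \<alpha>\<^sup>2)" for k
  proof -
    \<comment> \<open>This is the total rate out of \<open>k\<close> multiplied by
      \<open>1 + real k\<close>, so no denominator vanishes.\<close>
    have "0 < lam + real k * mu * (1 + real k)"
      using assms(1,2) by (simp add: add_pos_nonneg)
    then show ?thesis
      using assms(1) unfolding \<alpha> by (simp add: divide_simps) (simp add: algebra_simps)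
  qed
  have down: "?d k / (?b k + ?d k)
      = (real k * (real k + 1) * \<alpha>\<^sup>2) / (1 + real k * (real k + 1) * \<alpha>\<^sup>2)" for k
  proof -
    have "0 < lam + real k * mu * (1 + real k)"
      using assms(1,2) by (simp add: add_pos_nonneg)
    then show ?thesis
      using assms(1) unfolding \<alpha> by (simp add: divide_simps) (simp add: algebra_simps)
  qed
  have step: "p (Suc n) (Suc k) = 1 / (1 + real k * (real k + 1) * \<alpha>\<^sup>2) * p n k
      + (real (k + 2) * (real (k + 2) + 1) * \<alpha>\<^sup>2)
          / (1 + real (k + 2) * (real (k + 2) + 1) * \<alpha>\<^sup>2) * p n (k + 2)" for n k
    using bd_markov_chain_step(1)[OF chain, of n k]
    unfolding up down assms(6)[symmetric] by (simp only: mult.commute)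
  have zero: "p (Suc n) 0 = (2 * \<alpha>\<^sup>2) / (1 + 2 * \<alpha>\<^sup>2) * p n 1" for n
    using bd_markov_chain_step(2)[OF chain, of n]
    unfolding up down assms(6)[symmetric] by simp
  have init: "p 0 k = (if k = 0 then 1 else 0)" for k
  proof -
    \<comment> \<open>The zeroth jump time is 0, so the chain starts at \<open>X 0\<close>, which is
      0 almost surely.\<close>
    have "p 0 k = prob {\<omega> \<in> space M. X 0 \<omega> = k}"
      by (simp add: assms(6) jump_chain_def)
    also have "\<dots> = prob {\<omega> \<in> space M. 0 = k}"
    proof (rule measure_eq_AE)
      show "AE \<omega> in M. \<omega> \<in> {\<omega> \<in> space M. X 0 \<omega> = k} \<longleftrightarrow> \<omega> \<in> {\<omega> \<in> space M. 0 = k}"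
        using assms(5) by eventually_elim auto
    qed measurable
    finally show ?thesis
      by (simp add: prob_space)
  qed
  have closed: "p n k
      = (if k \<le> n \<and> even (n + k) then d_coeff \<alpha> k * T_coeff \<alpha> ((n - k) div 2) k else 0)" for n k
    using init step zero by (rule d_T_coeff_unique)
  have "p (n + 1) k =
      1 / (1 + real k * (real k - 1) * \<alpha>\<^sup>2) * p n (k - 1)
      + ((real k + 2) * (real k + 1) * \<alpha>\<^sup>2)
        / (1 + (real k + 2) * (real k + 1) * \<alpha>\<^sup>2) * p n (k + 1)" if "1 \<le> k" for n k
  proof -
    obtain j where k: "k = Suc j"
      using \<open>1 \<le> k\<close> by (cases k) auto
    \<comment> \<open>With \<open>k = Suc j\<close>, the products attached to the predecessors
      \<open>j\<close> and \<open>j + 2\<close> take the form used in the statement.\<close>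
    have "real (j + 2) * (real (j + 2) + 1) = (real k + 2) * (real k + 1)"
      "real j * (real j + 1) = real k * (real k - 1)"
      by (simp_all add: k algebra_simps)
    then show ?thesis
      using step[of n j] by (simp add: k ac_simps)
  qed
  moreover have "p n k = 0" if "k > n" for n k
    using that by (simp add: closed)
  moreover have "p 0 0 = 1"
    by (simp add: init)
  moreover have "p n k = d_coeff \<alpha> k * T_coeff \<alpha> ((n - k) div 2) k"
    if "k \<le> n \<and> even (n + k)" for n k
    using that by (simp add: closed)
  moreover have "p n k = 0" if "\<not> (k \<le> n \<and> even (n + k))" for n k
    unfolding closed using that by (rule if_not_P)
  ultimately show ?thesis
    by blast
qed

end
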